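(* Every ample positive integer $n$ is either abundant (i.e. $\sigma(n) - n > n$) or an odd perfect number (i.e. $n$ is odd and $\sigma(n) - n = n$).
   Context: $\sigma(n)$ denotes the sum of all positive divisors of $n$. For positive integers, write $m \lfloor n$ to mean that $m$ is a proper divisor of $n$. The number of recursive divisors is defined by $a(1)=1$ and $a(n) = 1 + \sum_{m \lfloor n} a(m)$ for $n>1$. A positive integer $n$ is ample if $a(n) > n$. *)

theory Defs
  imports Main
begin

definition proper_divisor :: "nat \<Rightarrow> nat \<Rightarrow> bool" where
  "proper_divisor m n \<longleftrightarrow> m dvd n \<and> m \<noteq> n"

text \<open>These functions are meant for positive arguments only; their values at 0 are irrelevant.\<close>

function num_rec_divisors :: "nat \<Rightarrow> nat" where
  "num_rec_divisors n =
     (if n \<le> 1 then 1 else 1 + (\<Sum>m | proper_divisor m n. num_rec_divisors m))"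
  by pat_completeness auto
termination
  by (relation "Wellfounded.measure id")
     (auto simp: proper_divisor_def dest: dvd_imp_le)

declare num_rec_divisors.simps [simp del]

definition divisor_sum :: "nat \<Rightarrow> nat" where
  "divisor_sum n = (\<Sum>d | d dvd n. d)"

definition ample :: "nat \<Rightarrow> bool" where
  "ample n \<longleftrightarrow> n > 0 \<and> num_rec_divisors n > n"

text \<open>The natural-number subtractions below never truncate, as \<open>n\<close> is one of the summands of
  \<open>divisor_sum n\<close> when \<open>n > 0\<close>.\<close>

definition abundant :: "nat \<Rightarrow> bool" where
  "abundant n \<longleftrightarrow> n > 0 \<and> divisor_sum n - n > n"

definition perfect :: "nat \<Rightarrow> bool" where
  "perfect n \<longleftrightarrow> n > 0 \<and> divisor_sum n - n = n"

end

theory Submission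
  imports Defs
begin

text \<open>Proper divisors of a non-abundant number are deficient, so strong induction gives
  \<open>a(n) \<le> 1 + (\<sigma>(n) - n)\<close> for all non-abundant \<open>n\<close>, hence \<open>a(n) \<le> n\<close> if \<open>n\<close> is deficient
  and \<open>a(n) \<le> n + 1\<close> if \<open>n\<close> is perfect. As \<open>a(n)\<close> is even for \<open>n > 1\<close>, the value \<open>n + 1\<close>
  is impossible for even \<open>n\<close>.\<close>

lemma finite_proper_divisors:
  assumes "n > 0"
  shows "finite {m. proper_divisor m n}"
proof (rule finite_subset)
  show "{m. proper_divisor m n} \<subseteq> {..n}"
    using assms by (auto simp: proper_divisor_def dest: dvd_imp_le)
qed simp

lemma proper_divisor_bounds:
  assumes "n > 0" and "proper_divisor m n"
  shows "0 < m" and "m < n"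
proof -
  have dvd: "m dvd n" "m \<noteq> n"
    using assms(2) by (simp_all add: proper_divisor_def)
  show "0 < m"
    using dvd assms(1) by (cases "m = 0") simp_all
  show "m < n"
    using dvd_imp_le[OF dvd(1) assms(1)] dvd(2) by simp
qed

lemma divisor_sum_eq_add_proper:
  assumes "n > 0"
  shows "divisor_sum n = n + (\<Sum>m | proper_divisor m n. m)"
proof -
  have "{d. d dvd n} = insert n {m. proper_divisor m n}"
    by (auto simp: proper_divisor_def)
  then show ?thesis
    unfolding divisor_sum_def using finite_proper_divisors[OF assms]
    by (simp add: proper_divisor_def)
qed

text \<open>Multiplication by \<open>k\<close> sends the divisors of \<open>m\<close> injectively to
  divisors of \<open>m * k\<close> that are multiples of \<open>k\<close>. The divisor 1 is missed
  because \<open>k > 1\<close>, which makes the inequality strict.\<close>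

lemma mult_divisor_sum_less:
  assumes "m > 0" and "k > 1"
  shows "k * divisor_sum m < divisor_sum (m * k)"
proof -
  have fin: "finite {d. d dvd m * k}" "finite {d. d dvd m}"
    using assms by (auto intro: finite_divisors_nat)
  have inj: "inj_on ((*) k) {d. d dvd m}"
    using assms by (auto intro: inj_onI)
  have new: "1 \<notin> (*) k ` {d. d dvd m}"
  proof
    assume "1 \<in> (*) k ` {d. d dvd m}"
    then obtain d where "k * d = 1"
      by (metis imageE)
    then show False
      using assms(2) by simp
  qed
  have sub: "insert 1 ((*) k ` {d. d dvd m}) \<subseteq> {d. d dvd m * k}"
    by (auto simp: mult.commute[of m k])
  have "k * divisor_sum m < (\<Sum>d \<in> insert 1 ((*) k ` {d. d dvd m}). d)"
    using new fin(2) inj by (simp add: divisor_sum_def sum_distrib_left sum.reindex)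
  also have "\<dots> \<le> divisor_sum (m * k)"
    unfolding divisor_sum_def using fin(1) sub by (intro sum_mono2) auto
  finally show ?thesis .
qed

text \<open>By \<open>mult_divisor_sum_less\<close>, the ratio of \<open>divisor_sum\<close> to its
  argument grows strictly from \<open>m\<close> to a proper multiple \<open>n\<close>; being at most
  2 at \<open>n\<close>, it is below 2 at \<open>m\<close>.\<close>

lemma proper_divisor_deficient:
  assumes "n > 0" and "divisor_sum n \<le> 2 * n" and "proper_divisor m n"
  shows "divisor_sum m < 2 * m"
proof -
  obtain k where k: "n = m * k"
    using assms(3) by (auto simp: proper_divisor_def)
  have "m > 0"
    using proper_divisor_bounds assms by blast
  moreover have "k > 1"
    using proper_divisor_bounds(2)[OF assms(1,3)] k by (cases "k = 0 \<or> k = 1") auto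
  ultimately have "k * divisor_sum m < divisor_sum n"
    unfolding k by (rule mult_divisor_sum_less)
  also have "\<dots> \<le> k * (2 * m)"
    using assms(2) k by (metis mult.assoc mult.commute)
  finally show ?thesis
    by simp
qed

text \<open>Deficiency passes to proper divisors, so by induction the recursive sum is at most the
  sum of the proper divisors. That sum is at most \<open>n - 1\<close>, which leaves room for the
  leading 1 of the recursion.\<close>

lemma num_rec_divisors_le_deficient:
  assumes "n > 0" and "divisor_sum n < 2 * n"
  shows "num_rec_divisors n \<le> n"
  using assms
proof (induction n rule: less_induct)
  case (less n)
  have "num_rec_divisors m \<le> m" if "proper_divisor m n" for m
  proof (rule less.IH)
    show "m < n" "m > 0"
      using proper_divisor_bounds less.prems(1) that by blast+
    show "divisor_sum m < 2 * m"
      using proper_divisor_deficient[OF less.prems(1) _ that] less.prems(2) by simp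
  qed
  then have "(\<Sum>m | proper_divisor m n. num_rec_divisors m) \<le> (\<Sum>m | proper_divisor m n. m)"
    by (intro sum_mono) simp
  then show ?case
    using divisor_sum_eq_add_proper[of n] less.prems num_rec_divisors.simps[of n]
    by (auto split: if_splits)
qed

text \<open>All proper divisors are deficient here too, but their sum may now equal
  \<open>n\<close>, so the leading 1 of the recursion can push the bound to
  \<open>Suc n\<close>.\<close>

lemma num_rec_divisors_le_Suc:
  assumes "n > 0" and "divisor_sum n \<le> 2 * n"
  shows "num_rec_divisors n \<le> Suc n"
proof -
  have "num_rec_divisors m \<le> m" if "proper_divisor m n" for m
    using num_rec_divisors_le_deficient proper_divisor_deficient[OF assms that] by simp
  then have "(\<Sum>m | proper_divisor m n. num_rec_divisors m) \<le> (\<Sum>m | proper_divisor m n. m)"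
    by (intro sum_mono) simp
  then show ?thesis
    using divisor_sum_eq_add_proper[of n] assms num_rec_divisors.simps[of n]
    by (auto split: if_splits)
qed

text \<open>The leading 1 of the recursion pairs with the summand of the divisor 1 to give 2; all
  other summands are even by induction.\<close>

lemma even_num_rec_divisors:
  assumes "n > 1"
  shows "even (num_rec_divisors n)"
  using assms
proof (induction n rule: less_induct)
  case (less n)
  let ?P = "{m. proper_divisor m n}"
  have one: "1 \<in> ?P"
    using less.prems by (simp add: proper_divisor_def)
  have "even (num_rec_divisors m)" if "m \<in> ?P - {1}" for m
  proof (rule less.IH)
    show "m < n" "m > 1"
      using proper_divisor_bounds[of n m] less.prems that by auto
  qed
  then have "even (\<Sum>m \<in> ?P - {1}. num_rec_divisors m)"
    by (intro dvd_sum) auto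
  moreover have "num_rec_divisors n = 2 + (\<Sum>m \<in> ?P - {1}. num_rec_divisors m)"
    using less.prems sum.remove[OF finite_proper_divisors one, of num_rec_divisors]
      num_rec_divisors.simps[of n] num_rec_divisors.simps[of 1] by simp
  ultimately show ?case
    by simp
qed

theorem theorem2:
  fixes n :: nat
  assumes "n > 0" and "ample n"
  shows "abundant n \<or> (odd n \<and> perfect n)"
proof (cases "divisor_sum n \<le> 2 * n")
  case True
  have gt: "num_rec_divisors n > n"
    using assms(2) by (simp add: ample_def)
  then have "num_rec_divisors n = Suc n"
    using num_rec_divisors_le_Suc[OF assms(1) True] by simp
  \<comment> \<open>For \<open>n > 1\<close> the value \<open>Suc n\<close> is even by parity;
    \<open>n = 1\<close> lies outside the parity lemma but is itself odd.\<close>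
  then have "odd n"
    using even_num_rec_divisors[of n] assms(1) by (cases "n = 1") auto
  \<comment> \<open>A strict inequality would make \<open>n\<close> deficient and contradict
    \<open>gt\<close>.\<close>
  moreover have "divisor_sum n = 2 * n"
    using num_rec_divisors_le_deficient[OF assms(1)] gt True by linarith
  ultimately show ?thesis
    using assms(1) by (simp add: perfect_def)
next
  case False
  then show ?thesis
    using assms(1) by (auto simp: abundant_def)
qed

end
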